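(* A connected graph $G$ is $2$-$\gamma_{\rm MB}$-critical if and only if $G$ is obtained from a star $K_{1,n}$, $n\ge 1$, with center $u$, and a disjoint complete bipartite graph $K_{2,m}$, $m\ge 2$, with bipartition $\{x_1,x_2\}$, $\{y_1,\dots,y_m\}$, by adding the two edges $ux_1$ and $ux_2$.
   Context: The Maker-Breaker domination (MBD) game on a graph $G$ is played by Dominator and Staller, who alternately select previously unselected vertices of $G$. Dominator wins if the set of vertices he has selected becomes a dominating set of $G$; Staller wins if she has selected at least one vertex of every dominating set of $G$. In the D-game Dominator moves first. $\gamma_{\rm MB}(G)$ is the minimum number $k$ such that Dominator has a strategy in the D-game guaranteeing that he wins having made at most $k$ moves, whatever Staller does; $\gamma_{\rm MB}(G)=\infty$ if Dominator has no winning strategy. A graph $G$ is $k$-$\gamma_{\rm MB}$-critical if $\gamma_{\rm MB}(G)=k$ and $\gamma_{\rm MB}(G)<\gamma_{\rm MB}(G-e)$ for every $e\in E(G)$. *)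

theory Defs
  imports "Graph_Theory.Graph_Theory" "HOL-Library.Extended_Nat"
begin

text \<open>
  A finite simple graph is a \<^locale>\<open>pair_graph\<close>: an undirected edge between \<open>a\<close> and \<open>b\<close> is
  the pair of arcs \<open>(a, b)\<close>, \<open>(b, a)\<close>. Adding and deleting edges acts on both arcs.
\<close>

definition add_edge :: "'a \<Rightarrow> 'a \<Rightarrow> 'a pair_pre_digraph \<Rightarrow> 'a pair_pre_digraph" where
  "add_edge a b G = \<lparr> pverts = pverts G \<union> {a, b}, parcs = parcs G \<union> {(a, b), (b, a)} \<rparr>"

definition del_edge :: "'a \<Rightarrow> 'a \<Rightarrow> 'a pair_pre_digraph \<Rightarrow> 'a pair_pre_digraph" where
  "del_edge a b G = \<lparr> pverts = pverts G, parcs = parcs G - {(a, b), (b, a)} \<rparr>"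

definition graph_union :: "'a pair_pre_digraph \<Rightarrow> 'a pair_pre_digraph \<Rightarrow> 'a pair_pre_digraph" where
  "graph_union G H = \<lparr> pverts = pverts G \<union> pverts H, parcs = parcs G \<union> parcs H \<rparr>"

text \<open>
  The library's predicate for complete bipartite graphs hides the two parts under an existential
  quantifier; here the parts have to be named.
\<close>

definition complete_bipartite_parts :: "'a set \<Rightarrow> 'a set \<Rightarrow> 'a pair_pre_digraph \<Rightarrow> bool" where
  "complete_bipartite_parts U W H \<longleftrightarrow> pair_graph H \<and> U \<inter> W = {} \<and>
     pverts H = U \<union> W \<and> parcs H = U \<times> W \<union> W \<times> U"

lemma complete_bipartite_digraph_iff_parts:
  "K\<^bsub>m,n\<^esub> (with_proj H) \<longleftrightarrow> (\<exists>U W. complete_bipartite_parts U W H \<and> card U = m \<and> card W = n)"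
proof
  assume A: "K\<^bsub>m,n\<^esub> (with_proj H)"
  then have "pair_graph H"
    by (simp add: complete_bipartite_digraph_def pair_graphI_graph)
  with A show "\<exists>U W. complete_bipartite_parts U W H \<and> card U = m \<and> card W = n"
    unfolding complete_bipartite_digraph_pair_def complete_bipartite_parts_def by blast
next
  assume "\<exists>U W. complete_bipartite_parts U W H \<and> card U = m \<and> card W = n"
  then show "K\<^bsub>m,n\<^esub> (with_proj H)"
    unfolding complete_bipartite_digraph_pair_def complete_bipartite_parts_def
    using pair_fin_digraph.pair_finite_verts pair_graph.axioms(1) pair_digraph.axioms(1) by blast
qed

definition dominating_set :: "'a pair_pre_digraph \<Rightarrow> 'a set \<Rightarrow> bool" where
  "dominating_set G D \<longleftrightarrow> D \<subseteq> pverts G \<and>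
     (\<forall>v\<in>pverts G. v \<in> D \<or> (\<exists>d\<in>D. (d, v) \<in> parcs G))"

text \<open>
  A play of the Maker-Breaker domination game is the list of the vertices selected so far, in
  order. In the D-game Dominator moves first, so his moves are those at even positions
  (counting from 0) and Staller's are those at odd positions. Plays are continued until all
  vertices are selected: moves made after the game has been decided do not affect its outcome.
\<close>

definition MB_play :: "'a pair_pre_digraph \<Rightarrow> 'a list \<Rightarrow> bool" where
  "MB_play G p \<longleftrightarrow> distinct p \<and> set p \<subseteq> pverts G"

definition dominator_moves :: "'a list \<Rightarrow> 'a list" where
  "dominator_moves p = nths p {i. even i}"

text \<open>A strategy of Dominator maps the play so far to his next move.\<close>

definition follows :: "('a list \<Rightarrow> 'a) \<Rightarrow> 'a list \<Rightarrow> bool" where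
  "follows \<sigma> p \<longleftrightarrow> (\<forall>i<length p. even i \<longrightarrow> p ! i = \<sigma> (take i p))"

definition dominator_strategy :: "'a pair_pre_digraph \<Rightarrow> ('a list \<Rightarrow> 'a) \<Rightarrow> bool" where
  "dominator_strategy G \<sigma> \<longleftrightarrow>
     (\<forall>p. MB_play G p \<and> follows \<sigma> p \<and> even (length p) \<and> set p \<noteq> pverts G
        \<longrightarrow> \<sigma> p \<in> pverts G - set p)"

definition wins_within :: "'a pair_pre_digraph \<Rightarrow> ('a list \<Rightarrow> 'a) \<Rightarrow> nat \<Rightarrow> bool" where
  "wins_within G \<sigma> k \<longleftrightarrow> dominator_strategy G \<sigma> \<and>
     (\<forall>p. MB_play G p \<and> follows \<sigma> p \<and> set p = pverts G
        \<longrightarrow> (\<exists>j\<le>k. dominating_set G (set (take j (dominator_moves p)))))"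

text \<open>The infimum of the empty set is \<open>\<infinity>\<close>.\<close>

definition gamma_MB :: "'a pair_pre_digraph \<Rightarrow> enat" where
  "gamma_MB G = Inf {enat k | k. \<exists>\<sigma>. wins_within G \<sigma> k}"

definition gamma_MB_critical :: "nat \<Rightarrow> 'a pair_pre_digraph \<Rightarrow> bool" where
  "gamma_MB_critical k G \<longleftrightarrow> gamma_MB G = enat k \<and>
     (\<forall>(a, b)\<in>parcs G. gamma_MB G < gamma_MB (del_edge a b G))"

end

theory Submission
  imports Defs
begin

text \<open>
  Dominator wins within two moves exactly when some vertex dominates alone, or some vertex \<open>d\<close> forms
  a dominating pair with two different partners, so that Staller cannot take both. Criticality then
  says that no edge is superfluous for the two pairs \<open>{d, a}\<close>, \<open>{d, b}\<close>: every edge not at \<open>d\<close> joins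
  \<open>a\<close> or \<open>b\<close> to a non-neighbour of \<open>d\<close>. If only one of \<open>a\<close>, \<open>b\<close> were adjacent to \<open>d\<close>, that edge
  would be superfluous, and if none were, \<open>G\<close> would be disconnected; so both are.
  Conversely, a leaf and a vertex of \<open>Y\<close> have disjoint closed neighbourhoods, which forces
  \<open>{u, x\<^sub>1}\<close> and \<open>{u, x\<^sub>2}\<close> to be the only dominating pairs, and every edge is needed by one of them.
\<close>

section \<open>Short wins of Dominator\<close>

text \<open>The infimum of a nonempty set in \<open>enat\<close> is attained, and a bound
  \<open>enat k\<close> rules out the empty set, whose infimum is \<open>\<infinity>\<close>. A win
  within \<open>j\<close> moves is also a win within any \<open>k \<ge> j\<close>.\<close>

lemma gamma_MB_le_iff: "gamma_MB G \<le> enat k \<longleftrightarrow> (\<exists>\<sigma>. wins_within G \<sigma> k)"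
proof
  assume le: "gamma_MB G \<le> enat k"
  let ?A = "{enat k | k. \<exists>\<sigma>. wins_within G \<sigma> k}"
  have "?A \<noteq> {}"
    using le unfolding gamma_MB_def Inf_enat_def by (auto split: if_splits)
  then have "gamma_MB G \<in> ?A"
    unfolding gamma_MB_def Inf_enat_def using LeastI[of "\<lambda>x. x \<in> ?A"] by (simp del: mem_Collect_eq) blast
  then obtain j \<sigma> where "gamma_MB G = enat j" "wins_within G \<sigma> j" by blast
  with le show "\<exists>\<sigma>. wins_within G \<sigma> k"
    unfolding wins_within_def by (metis enat_ord_simps(1) order_trans)
next
  assume "\<exists>\<sigma>. wins_within G \<sigma> k"
  then show "gamma_MB G \<le> enat k"
    unfolding gamma_MB_def by (intro Inf_lower) blast
qed

lemma follows_append_single: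
  "follows \<sigma> (p @ [v]) \<longleftrightarrow> follows \<sigma> p \<and> (even (length p) \<longrightarrow> v = \<sigma> p)"
  unfolding follows_def by (auto simp: nth_append less_Suc_eq)

lemma dominator_moves_Nil [simp]: "dominator_moves [] = []"
  by (simp add: dominator_moves_def)

lemma dominator_moves_single [simp]: "dominator_moves [x] = [x]"
  by (simp add: dominator_moves_def nths_Cons)

lemma dominator_moves_Cons_Cons [simp]: "dominator_moves (x # y # p) = x # dominator_moves p"
  by (simp add: dominator_moves_def nths_Cons)

text \<open>\<open>wins_within\<close> speaks only of plays that exhaust the vertices, so a short
  play must be completed before it yields information. Dominator continues by
  \<open>\<sigma>\<close>, Staller arbitrarily; the induction is on the number of unselected
  vertices.\<close>

lemma MB_play_extend:
  assumes "finite (pverts G)" "dominator_strategy G \<sigma>" "MB_play G p" "follows \<sigma> p"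
  obtains q where "MB_play G (p @ q)" "follows \<sigma> (p @ q)" "set (p @ q) = pverts G"
  using assms(3,4)
proof (induction "card (pverts G - set p)" arbitrary: p thesis rule: less_induct)
  case less
  show thesis
  proof (cases "set p = pverts G")
    case True
    with less show ?thesis by (metis append_Nil2)
  next
    case False
    obtain v where v: "v \<in> pverts G - set p" "even (length p) \<longrightarrow> v = \<sigma> p"
    proof (cases "even (length p)")
      case True
      with False less.prems that show ?thesis
        using assms(2) unfolding dominator_strategy_def by blast
    next
      case odd: False
      with False less.prems that show ?thesis unfolding MB_play_def by blast
    qed
    have 1: "card (pverts G - set (p @ [v])) < card (pverts G - set p)"
      using v assms(1) by (intro psubset_card_mono) auto
    have 2: "MB_play G (p @ [v])" using v less.prems unfolding MB_play_def by auto
    have 3: "follows \<sigma> (p @ [v])" using v less.prems by (simp add: follows_append_single)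
    obtain q where "MB_play G ((p @ [v]) @ q)" "follows \<sigma> ((p @ [v]) @ q)"
      "set ((p @ [v]) @ q) = pverts G"
      using less.hyps[OF 1 _ 2 3] by blast
    then show ?thesis using less.prems(1)[of "v # q"] by simp
  qed
qed

lemma dominating_set_mono:
  "dominating_set G D \<Longrightarrow> D \<subseteq> D' \<Longrightarrow> D' \<subseteq> pverts G \<Longrightarrow> dominating_set G D'"
  unfolding dominating_set_def by blast

lemma wins_within_one_iff:
  assumes "finite (pverts G)" "pverts G \<noteq> {}"
  shows "(\<exists>\<sigma>. wins_within G \<sigma> 1) \<longleftrightarrow> (\<exists>d. dominating_set G {d})"
proof
  assume "\<exists>\<sigma>. wins_within G \<sigma> 1"
  then obtain \<sigma> where W: "wins_within G \<sigma> 1" ..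
  then have S: "dominator_strategy G \<sigma>" by (simp add: wins_within_def)
  have d: "\<sigma> [] \<in> pverts G"
    using S assms(2) unfolding dominator_strategy_def
    by (auto simp: MB_play_def follows_def dest: spec[of _ "[]"])
  obtain q where q: "MB_play G (\<sigma> [] # q)" "follows \<sigma> (\<sigma> [] # q)" "set (\<sigma> [] # q) = pverts G"
    by (rule MB_play_extend[OF assms(1) S, of "[\<sigma> []]"])
      (use d in \<open>auto simp: MB_play_def follows_def\<close>)
  obtain j where j: "j \<le> 1" "dominating_set G (set (take j (dominator_moves (\<sigma> [] # q))))"
    using W q unfolding wins_within_def by blast
  \<comment> \<open>Only an inclusion holds, as \<open>j\<close> may be 0; monotonicity of
    domination makes up for this.\<close>
  have "set (take j (dominator_moves (\<sigma> [] # q))) \<subseteq> {\<sigma> []}"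
    using j(1) by (cases q) (auto simp: le_Suc_eq)
  with j(2) d have "dominating_set G {\<sigma> []}"
    by (auto intro: dominating_set_mono)
  then show "\<exists>d. dominating_set G {d}" ..
next
  assume "\<exists>d. dominating_set G {d}"
  then obtain d where d: "dominating_set G {d}" ..
  then have dV: "d \<in> pverts G" by (simp add: dominating_set_def)
  \<comment> \<open>Only the opening move matters; the choice by \<open>SOME\<close> just keeps the
    later moves legal.\<close>
  define \<sigma> where "\<sigma> p = (if p = [] then d else SOME v. v \<in> pverts G - set p)" for p
  have "dominator_strategy G \<sigma>"
    unfolding dominator_strategy_def
  proof (intro allI impI)
    fix p assume "MB_play G p \<and> follows \<sigma> p \<and> even (length p) \<and> set p \<noteq> pverts G"
    then have "\<exists>v. v \<in> pverts G - set p" unfolding MB_play_def by blast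
    then have "(SOME v. v \<in> pverts G - set p) \<in> pverts G - set p" by (rule someI_ex)
    with dV show "\<sigma> p \<in> pverts G - set p" by (simp add: \<sigma>_def)
  qed
  moreover have "dominating_set G (set (take 1 (dominator_moves p)))"
    if p: "follows \<sigma> p" "set p = pverts G" for p
  proof -
    have ne: "p \<noteq> []" using p(2) assms(2) by auto
    then have "p ! 0 = \<sigma> []" using p(1) unfolding follows_def by auto
    then obtain q where "p = d # q" using ne by (cases p) (auto simp: \<sigma>_def)
    then show ?thesis using d by (cases q) auto
  qed
  ultimately show "\<exists>\<sigma>. wins_within G \<sigma> 1" unfolding wins_within_def by blast
qed

section \<open>Forks and wins within two moves\<close>

definition has_dominating_fork :: "'a pair_pre_digraph \<Rightarrow> bool" where
  "has_dominating_fork G \<longleftrightarrow>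
     (\<exists>d a b. distinct [d, a, b] \<and> dominating_set G {d, a} \<and> dominating_set G {d, b})"

text \<open>With \<open>d\<close> the opening move of \<open>\<sigma>\<close>, a first reply of
  Staller yields \<open>a\<close>, and the reply \<open>a\<close> itself yields a different
  \<open>b\<close>. The assumption \<open>nodom\<close> matters: on one or two vertices Dominator
  can win although three distinct vertices do not exist.\<close>

lemma wins_within_two_imp:
  assumes "finite (pverts G)" "pverts G \<noteq> {}" "wins_within G \<sigma> 2"
    and nodom: "\<And>d. \<not> dominating_set G {d}"
  shows "has_dominating_fork G"
proof -
  have S: "dominator_strategy G \<sigma>" using assms(3) by (simp add: wins_within_def)
  define d where "d = \<sigma> []"
  have d: "d \<in> pverts G"
    using S assms(2) unfolding dominator_strategy_def d_def
    by (auto simp: MB_play_def follows_def dest: spec[of _ "[]"])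
  have reply: "\<exists>t. t \<noteq> d \<and> t \<noteq> s \<and> dominating_set G {d, t}" if s: "s \<in> pverts G" "s \<noteq> d" for s
  proof -
    have ds: "MB_play G [d, s]" "follows \<sigma> [d, s]"
      using d s by (auto simp: MB_play_def follows_def d_def less_Suc_eq)
    obtain q where q: "MB_play G (d # s # q)" "follows \<sigma> (d # s # q)" "set (d # s # q) = pverts G"
      using MB_play_extend[OF assms(1) S ds] by auto
    obtain j where j: "j \<le> 2" "dominating_set G (set (take j (dominator_moves (d # s # q))))"
      using assms(3) q unfolding wins_within_def by blast
    show ?thesis
    proof (cases q)
      \<comment> \<open>Here \<open>d\<close> and \<open>s\<close> are all the vertices, so
        Dominator has made one move only.\<close>
      case Nil
      then have "set (take j (dominator_moves (d # s # q))) \<subseteq> {d}"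
        by (auto dest: in_set_takeD)
      with j(2) d have "dominating_set G {d}" by (auto intro: dominating_set_mono)
      with nodom show ?thesis by blast
    next
      case (Cons t r)
      have "set (take j (dominator_moves (d # s # q))) \<subseteq> set (take 2 (dominator_moves (d # s # q)))"
        using j(1) by (rule set_take_subset_set_take)
      also have "\<dots> = {d, t}" using Cons by (cases r) auto
      finally have "dominating_set G {d, t}"
        using j(2) q(3) d Cons by (auto intro: dominating_set_mono)
      moreover have "t \<noteq> d" "t \<noteq> s" using q(1) Cons by (auto simp: MB_play_def)
      ultimately show ?thesis by blast
    qed
  qed
  have "\<exists>s. s \<in> pverts G \<and> s \<noteq> d"
    using nodom[of d] d unfolding dominating_set_def by blast
  then obtain a where a: "a \<noteq> d" "dominating_set G {d, a}" using reply by blast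
  then have "a \<in> pverts G" by (simp add: dominating_set_def)
  then obtain b where "b \<noteq> d" "b \<noteq> a" "dominating_set G {d, b}" using reply a by blast
  moreover from this a have "distinct [d, a, b]" by simp
  ultimately show ?thesis using a(2) unfolding has_dominating_fork_def by blast
qed

lemma wins_within_two_if_fork:
  assumes "finite (pverts G)" "has_dominating_fork G"
  shows "\<exists>\<sigma>. wins_within G \<sigma> 2"
proof -
  obtain d a b where D: "distinct [d, a, b]" "dominating_set G {d, a}" "dominating_set G {d, b}"
    using assms(2) unfolding has_dominating_fork_def by blast
  then have V: "{d, a, b} \<subseteq> pverts G" by (simp add: dominating_set_def)
  \<comment> \<open>A play of length 2 is \<open>[d, s]\<close>, where Dominator makes his second
    move. If \<open>a\<close> occurs in it, then \<open>s = a\<close> and \<open>b\<close> is free;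
    otherwise \<open>a\<close> is free.\<close>
  define \<sigma> where "\<sigma> p = (if p = [] then d else if length p = 2 then (if a \<in> set p then b else a)
    else SOME v. v \<in> pverts G - set p)" for p
  have start: "\<exists>q. p = d # q" if "follows \<sigma> p" "p \<noteq> []" for p
  proof -
    have "p ! 0 = \<sigma> []" using that unfolding follows_def by auto
    then show ?thesis using that by (cases p) (auto simp: \<sigma>_def)
  qed
  have "dominator_strategy G \<sigma>"
    unfolding dominator_strategy_def
  proof (intro allI impI)
    fix p assume p: "MB_play G p \<and> follows \<sigma> p \<and> even (length p) \<and> set p \<noteq> pverts G"
    consider "p = []" | "length p = 2" | "p \<noteq> []" "length p \<noteq> 2" by blast
    then show "\<sigma> p \<in> pverts G - set p"
    proof cases
      case 2
      then obtain s where "p = [d, s]" using start[of p] p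
        by (auto simp: length_Suc_conv numeral_2_eq_2)
      then show ?thesis using D(1) V p by (auto simp: \<sigma>_def)
    next
      case 3
      from p have "\<exists>v. v \<in> pverts G - set p" unfolding MB_play_def by blast
      then have "(SOME v. v \<in> pverts G - set p) \<in> pverts G - set p" by (rule someI_ex)
      with 3 show ?thesis by (simp add: \<sigma>_def)
    qed (use V in \<open>simp add: \<sigma>_def\<close>)
  qed
  moreover have "dominating_set G (set (take 2 (dominator_moves p)))"
    if p: "MB_play G p" "follows \<sigma> p" "set p = pverts G" for p
  proof -
    \<comment> \<open>The three vertices of the fork ensure that a complete play reaches Dominator's
      second move, at position 2.\<close>
    have "card {d, a, b} \<le> card (set p)" using V p(3) assms(1) by (metis card_mono)
    then have len: "3 \<le> length p" using D(1) card_length[of p] by simp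
    then obtain q where "p = d # q" using start[OF p(2)] by fastforce
    moreover obtain s t r where "q = s # t # r"
      using len \<open>p = d # q\<close> by (cases q; cases "tl q") auto
    ultimately have pp: "p = d # s # t # r" by simp
    have "p ! 2 = \<sigma> (take 2 p)" using p(2) len unfolding follows_def by auto
    then have "t = \<sigma> [d, s]" by (simp add: pp)
    then have "t \<in> {a, b}" by (simp add: \<sigma>_def)
    then show ?thesis using D pp by (cases r) (auto simp: insert_commute)
  qed
  ultimately show ?thesis unfolding wins_within_def by blast
qed

section \<open>Critical graphs\<close>

lemma pverts_del_edge [simp]: "pverts (del_edge x y G) = pverts G"
  and parcs_del_edge [simp]: "parcs (del_edge x y G) = parcs G - {(x, y), (y, x)}"
  by (simp_all add: del_edge_def)

lemma dominating_set_del_edgeD: "dominating_set (del_edge x y G) D \<Longrightarrow> dominating_set G D"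
  unfolding dominating_set_def by auto

text \<open>Deleting an edge creates no dominating set, so if no vertex dominates \<open>G\<close>
  alone, none does after a deletion. The value is then at most 2 exactly when there is a fork, both
  for \<open>G\<close> and for each \<open>del_edge x y G\<close>.\<close>

lemma gamma_MB_critical_2_iff:
  assumes "finite (pverts G)" "pverts G \<noteq> {}"
  shows "gamma_MB_critical 2 G \<longleftrightarrow> (\<forall>d. \<not> dominating_set G {d}) \<and> has_dominating_fork G \<and>
    (\<forall>(x, y) \<in> parcs G. \<not> has_dominating_fork (del_edge x y G))"
proof -
  have one: "gamma_MB G \<le> enat 1 \<longleftrightarrow> (\<exists>d. dominating_set G {d})"
    using wins_within_one_iff[OF assms] by (simp add: gamma_MB_le_iff)
  have two: "gamma_MB H \<le> enat 2 \<longleftrightarrow> has_dominating_fork H"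
    if "pverts H = pverts G" "\<forall>d. \<not> dominating_set H {d}" for H :: "'a pair_pre_digraph"
    using that assms wins_within_two_imp[of H] wins_within_two_if_fork[of H]
    by (auto simp: gamma_MB_le_iff)
  have del: "gamma_MB (del_edge x y G) \<le> enat 2 \<longleftrightarrow> has_dominating_fork (del_edge x y G)"
    if "\<forall>d. \<not> dominating_set G {d}" for x y
    using that by (intro two) (auto dest: dominating_set_del_edgeD)
  have eq: "gamma_MB G = enat 2 \<longleftrightarrow> gamma_MB G \<le> enat 2 \<and> \<not> gamma_MB G \<le> enat 1"
    by (cases "gamma_MB G") auto
  show ?thesis
  proof (cases "\<exists>d. dominating_set G {d}")
    case True
    then show ?thesis using one eq by (auto simp: gamma_MB_critical_def)
  next
    case False
    then have "gamma_MB_critical 2 G \<longleftrightarrow> gamma_MB G = enat 2 \<and>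
        (\<forall>(x, y) \<in> parcs G. \<not> has_dominating_fork (del_edge x y G))"
      using del by (auto simp: gamma_MB_critical_def not_le[symmetric])
    then show ?thesis using False two[of G] one eq by simp
  qed
qed

text \<open>Deleting the edge must spoil one of the two pairs. The endpoint left undominated was
  dominated through this edge alone, by \<open>a\<close> or \<open>b\<close>, and hence is not
  adjacent to \<open>d\<close>.\<close>

lemma edge_needed_by_fork:
  assumes "distinct [d, a, b]" "dominating_set G {d, a}" "dominating_set G {d, b}"
    and "sym (parcs G)" "(x, y) \<in> parcs G" "\<not> has_dominating_fork (del_edge x y G)"
    and "x \<noteq> d" "y \<noteq> d"
  shows "x \<in> {a, b} \<and> (d, y) \<notin> parcs G \<or> y \<in> {a, b} \<and> (d, x) \<notin> parcs G"
proof -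
  have "\<exists>c \<in> {a, b}. \<not> dominating_set (del_edge x y G) {d, c}"
    using assms(1,6) unfolding has_dominating_fork_def by blast
  then obtain c where c: "c \<in> {a, b}" "\<not> dominating_set (del_edge x y G) {d, c}" by blast
  have "dominating_set G {d, c}" using c(1) assms by auto
  \<comment> \<open>The vertex \<open>v\<close> has lost a dominating arc. Arcs at \<open>d\<close>
    survive, as neither endpoint is \<open>d\<close>, so the lost arc is
    \<open>(c, v)\<close>.\<close>
  with c(2) obtain v where v: "v \<noteq> d" "v \<noteq> c" "(d, v) \<in> parcs G \<or> (c, v) \<in> parcs G"
    "(d, v) \<notin> parcs (del_edge x y G)" "(c, v) \<notin> parcs (del_edge x y G)"
    unfolding dominating_set_def by auto
  then show ?thesis using c(1) assms(7,8) by auto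
qed

lemma has_dominating_forkI:
  assumes "distinct [d, a, b]" "dominating_set G {d, a}" "dominating_set G {d, b}"
  shows "has_dominating_fork G"
  using assms unfolding has_dominating_fork_def by blast

section \<open>The structure forced by criticality\<close>

locale critical_fork = pair_graph G for G :: "'a pair_pre_digraph" +
  fixes d a b :: 'a
  assumes conn: "Digraph_Component.connected (with_proj G)"
    and dist: "distinct [d, a, b]"
    and dom_a: "dominating_set G {d, a}" and dom_b: "dominating_set G {d, b}"
    and no_single: "\<And>v. \<not> dominating_set G {v}"
    and critical: "\<And>x y. (x, y) \<in> parcs G \<Longrightarrow> \<not> has_dominating_fork (del_edge x y G)"
begin

lemma swap: "critical_fork G d b a"
  using conn dist dom_a dom_b no_single critical by unfold_locales auto

lemma sym: "sym (parcs G)"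
  using pair_sym_arcs by (simp add: symmetric_def)

lemma in_verts: "d \<in> pverts G" "a \<in> pverts G" "b \<in> pverts G"
  using dom_a dom_b by (auto simp: dominating_set_def)

lemma no_loop: "(x, x) \<notin> parcs G"
  using pair_no_loops by fastforce

lemma edge_cases:
  assumes "(x, y) \<in> parcs G" "x \<noteq> d" "y \<noteq> d"
  shows "x \<in> {a, b} \<and> (d, y) \<notin> parcs G \<or> y \<in> {a, b} \<and> (d, x) \<notin> parcs G"
  using edge_needed_by_fork[OF dist dom_a dom_b sym assms(1) critical[OF assms(1)] assms(2,3)] .

lemma some_adjacent: "(d, a) \<in> parcs G \<or> (d, b) \<in> parcs G"
proof (rule ccontr)
  assume non: "\<not> ?thesis"
  have "strongly_connected (with_proj G)"
    using conn pair_sym_arcs by (intro symmetric_connected_imp_strongly_connected) auto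
  then have "d \<rightarrow>\<^sup>*\<^bsub>with_proj G\<^esub> a"
    using in_verts by (auto simp: strongly_connected_def)
  \<comment> \<open>The invariant is that \<open>d\<close> with its neighbours is closed under arcs:
    by \<open>edge_cases\<close>, an edge avoiding \<open>d\<close> has an end in
    \<open>{a, b}\<close>, here a non-neighbour of \<open>d\<close>, and its other end is a
    non-neighbour too.\<close>
  then have "a = d \<or> (d, a) \<in> parcs G"
  proof (induction rule: reachable_induct)
    case (step x y)
    then have "(x, y) \<in> parcs G" by simp
    then show ?case using step.IH edge_cases[of x y] non by auto
  qed simp
  then show False using dist non by auto
qed

text \<open>Otherwise \<open>b\<close> is the neighbour of \<open>d\<close>, and the pair
  \<open>{d, b}\<close> must dominate \<open>a\<close> through an edge \<open>ab\<close>. Then the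
  edge \<open>db\<close> can be deleted: \<open>a\<close> dominates \<open>b\<close> in the first
  pair, and the second pair contains both ends.\<close>

lemma adjacent_a: "(d, a) \<in> parcs G"
proof (rule ccontr)
  assume non: "(d, a) \<notin> parcs G"
  with some_adjacent have db: "(d, b) \<in> parcs G" by simp
  have ab: "(a, b) \<in> parcs G"
    using dom_b non dist in_verts symD[OF sym] unfolding dominating_set_def by auto
  have "dominating_set (del_edge d b G) {d, a}"
    using dom_a ab dist unfolding dominating_set_def by auto
  moreover have "dominating_set (del_edge d b G) {d, b}"
    using dom_b dist unfolding dominating_set_def by auto
  ultimately show False
    using has_dominating_forkI[OF dist] critical[OF db] by blast
qed

lemma adjacent_b: "(d, b) \<in> parcs G"
  using critical_fork.adjacent_a[OF swap] .

text \<open>\<open>Y\<close> is to be the side of size \<open>m\<close>, and \<open>L\<close> the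
  leaves of the star. That the members of \<open>L\<close> have no neighbour besides
  \<open>d\<close> only follows from \<open>parcs_eq\<close>.\<close>

definition "Y = {v \<in> pverts G. v \<noteq> d \<and> (d, v) \<notin> parcs G}"
definition "L = {v. (d, v) \<in> parcs G} - {a, b}"

lemma pverts_eq: "pverts G = {d} \<union> L \<union> {a, b} \<union> Y"
  using in_verts adjacent_a adjacent_b by (auto simp: Y_def L_def dest: in_arcsD2)

lemma disjoint: "d \<notin> L" "d \<notin> Y" "L \<inter> Y = {}" "{a, b} \<inter> L = {}" "{a, b} \<inter> Y = {}"
  using adjacent_a adjacent_b no_loop by (auto simp: Y_def L_def)

text \<open>Edges avoiding \<open>d\<close> are confined by \<open>edge_cases\<close>. Conversely,
  \<open>d\<close> dominates no vertex of \<open>Y\<close>, so \<open>a\<close> and \<open>b\<close>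
  must each dominate all of \<open>Y\<close>.\<close>

lemma parcs_eq: "parcs G = {d} \<times> (L \<union> {a, b}) \<union> (L \<union> {a, b}) \<times> {d} \<union> {a, b} \<times> Y \<union> Y \<times> {a, b}"
  (is "_ = ?E")
proof (intro equalityI subrelI)
  fix x y assume e: "(x, y) \<in> parcs G"
  then have e': "(y, x) \<in> parcs G" by (rule symD[OF sym])
  from e have V: "x \<in> pverts G" "y \<in> pverts G" by (auto dest: in_arcsD1 in_arcsD2)
  consider "x = d" | "y = d" | "x \<noteq> d" "y \<noteq> d" by blast
  then show "(x, y) \<in> ?E"
  proof cases
    case 3
    then show ?thesis using edge_cases[OF e] V by (auto simp: Y_def)
  qed (use e e' in \<open>auto simp: L_def\<close>)
next
  fix x y assume "(x, y) \<in> ?E"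
  moreover have "(a, v) \<in> parcs G" "(b, v) \<in> parcs G" if "v \<in> Y" for v
    using that dom_a dom_b disjoint unfolding dominating_set_def Y_def by auto
  ultimately show "(x, y) \<in> parcs G"
    using adjacent_a adjacent_b by (auto simp: L_def intro: symD[OF sym])
qed

lemma L_nonempty: "L \<noteq> {}"
proof
  assume L: "L = {}"
  have "distinct [a, d, b]" using dist by auto
  moreover have "dominating_set (del_edge d a G) {a, d}" "dominating_set (del_edge d a G) {a, b}"
    using dist disjoint unfolding dominating_set_def
    by (auto simp: pverts_eq parcs_eq L)
  ultimately have "has_dominating_fork (del_edge d a G)" by (rule has_dominating_forkI)
  with critical[OF adjacent_a] show False ..
qed

lemma finite_L: "finite L" and finite_Y: "finite Y"
  using pair_finite_verts by (auto simp: pverts_eq)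

lemma card_Y: "2 \<le> card Y"
proof (rule ccontr)
  assume "\<not> 2 \<le> card Y"
  then have "card Y = 0 \<or> card Y = 1" by linarith
  then consider "Y = {}" | y where "Y = {y}"
    using finite_Y by (auto simp: card_1_singleton_iff)
  then show False
  proof cases
    case 1
    then have "dominating_set G {d}"
      unfolding dominating_set_def by (auto simp: pverts_eq parcs_eq)
    with no_single show False by blast
  next
    case 2
    have "distinct [d, b, y]" using dist disjoint 2 by auto
    moreover have "dominating_set (del_edge a y G) {d, b}" "dominating_set (del_edge a y G) {d, y}"
      using dist disjoint 2 unfolding dominating_set_def
      by (auto simp: pverts_eq parcs_eq)
    ultimately have "has_dominating_fork (del_edge a y G)" by (rule has_dominating_forkI)
    moreover have "(a, y) \<in> parcs G" using 2 by (simp add: parcs_eq)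
    ultimately show False using critical by blast
  qed
qed

end

section \<open>Stars joined to complete bipartite graphs\<close>

lemma complete_bipartite_parts_record:
  assumes "finite U" "finite W" "U \<inter> W = {}"
  shows "complete_bipartite_parts U W \<lparr> pverts = U \<union> W, parcs = U \<times> W \<union> W \<times> U \<rparr>"
proof -
  have "pair_graph \<lparr> pverts = U \<union> W, parcs = U \<times> W \<union> W \<times> U \<rparr>"
    using assms by unfold_locales (auto simp: symmetric_def sym_def)
  with assms show ?thesis by (simp add: complete_bipartite_parts_def)
qed

text \<open>The vertices and arcs are described as in \<open>critical_fork\<close>, with
  \<open>u\<close>, \<open>x1\<close>, \<open>x2\<close> for \<open>d\<close>, \<open>a\<close>,
  \<open>b\<close>. \<open>Y_two\<close> expresses that \<open>Y\<close> has at least two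
  elements.\<close>

locale star_joined_K2m =
  fixes G :: "'a pair_pre_digraph" and u x1 x2 :: 'a and L Y :: "'a set"
  assumes pverts_eq: "pverts G = {u} \<union> L \<union> {x1, x2} \<union> Y"
    and parcs_eq: "parcs G = {u} \<times> (L \<union> {x1, x2}) \<union> (L \<union> {x1, x2}) \<times> {u} \<union>
      {x1, x2} \<times> Y \<union> Y \<times> {x1, x2}"
    and disj: "u \<notin> L" "u \<notin> Y" "u \<noteq> x1" "u \<noteq> x2" "x1 \<noteq> x2" "L \<inter> Y = {}"
      "{x1, x2} \<inter> L = {}" "{x1, x2} \<inter> Y = {}"
    and L_nonempty: "L \<noteq> {}"
    and Y_two: "\<And>y. \<exists>y' \<in> Y. y' \<noteq> y"
begin

lemma dominating_pairs:
  assumes "dominating_set G {p, q}"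
  shows "{p, q} = {u, x1} \<or> {p, q} = {u, x2}"
proof -
  have dom: "v = p \<or> v = q \<or> (p, v) \<in> parcs G \<or> (q, v) \<in> parcs G" if "v \<in> pverts G" for v
    using that assms unfolding dominating_set_def by blast
  obtain l where l: "l \<in> L" using L_nonempty by blast
  obtain y where y: "y \<in> Y" using Y_two by blast
  have "u \<in> {p, q} \<or> l \<in> {p, q}"
    using dom[of l] l disj by (auto simp: pverts_eq parcs_eq)
  moreover have Y: "x1 \<in> {p, q} \<or> x2 \<in> {p, q} \<or> z \<in> {p, q}" if "z \<in> Y" for z
    using dom[of z] that disj by (auto simp: pverts_eq parcs_eq)
  moreover obtain y' where "y' \<in> Y" "y' \<noteq> y" using Y_two by blast
  \<comment> \<open>If \<open>y\<close> were the member dominating \<open>y\<close>, then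
    \<open>y'\<close> would require yet another member besides the one dominating
    \<open>l\<close>.\<close>
  ultimately have "(u \<in> {p, q} \<or> l \<in> {p, q}) \<and> (x1 \<in> {p, q} \<or> x2 \<in> {p, q})"
    using y l disj by (auto; blast)
  \<comment> \<open>A leaf cannot stand in for \<open>u\<close>, since neither it nor one of
    \<open>x1\<close>, \<open>x2\<close> dominates the other of these two.\<close>
  moreover have "{p, q} \<noteq> {l, x1}"
    using dom[of x2] l disj by (auto simp: pverts_eq parcs_eq doubleton_eq_iff)
  moreover have "{p, q} \<noteq> {l, x2}"
    using dom[of x1] l disj by (auto simp: pverts_eq parcs_eq doubleton_eq_iff)
  ultimately show ?thesis
    using l disj by (auto simp: doubleton_eq_iff)
qed

lemma no_dominating_vertex: "\<not> dominating_set G {v}"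
proof
  assume "dominating_set G {v}"
  \<comment> \<open>\<open>dominating_pairs\<close> allows \<open>p = q\<close>, and a singleton is
    not a set of two distinct vertices.\<close>
  then show False using dominating_pairs[of v v] disj by auto
qed

lemma has_fork: "has_dominating_fork G"
proof (rule has_dominating_forkI)
  show "distinct [u, x1, x2]" using disj by simp
qed (auto simp: dominating_set_def pverts_eq parcs_eq)

lemma no_fork_del_edge:
  assumes "(x, y) \<in> parcs G"
  shows "\<not> has_dominating_fork (del_edge x y G)"
proof
  assume "has_dominating_fork (del_edge x y G)"
  then obtain d a b where D: "distinct [d, a, b]"
    "dominating_set (del_edge x y G) {d, a}" "dominating_set (del_edge x y G) {d, b}"
    unfolding has_dominating_fork_def by blast
  \<comment> \<open>The two pairs of a fork differ, so they are exactly the two available ones, and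
    both must survive the deletion.\<close>
  have "{d, a} \<noteq> {d, b}" using D(1) by (auto simp: doubleton_eq_iff)
  with dominating_pairs[OF dominating_set_del_edgeD[OF D(2)]]
    dominating_pairs[OF dominating_set_del_edgeD[OF D(3)]]
  have "{d, a} = {u, x1} \<and> {d, b} = {u, x2} \<or> {d, a} = {u, x2} \<and> {d, b} = {u, x1}"
    by metis
  then have "dominating_set (del_edge x y G) {u, x1}" "dominating_set (del_edge x y G) {u, x2}"
    using D(2,3) by metis+
  then have dom: "v = u \<or> v = c \<or> (u, v) \<in> parcs (del_edge x y G) \<or> (c, v) \<in> parcs (del_edge x y G)"
    if "v \<in> pverts G" "c \<in> {x1, x2}" for v c
    using that unfolding dominating_set_def by auto
  let ?R = "{(x, y), (y, x)}"
  \<comment> \<open>In each case one pair leaves an endpoint undominated: a leaf \<open>z\<close>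
    loses \<open>u\<close>; \<open>x1\<close> is lost to \<open>{u, x2}\<close>, and
    \<open>x2\<close> to \<open>{u, x1}\<close>; a vertex \<open>z\<close> of \<open>Y\<close> is
    lost to \<open>{u, c}\<close>.\<close>
  consider z where "(u, z) \<in> ?R" "z \<in> L" | "(u, x1) \<in> ?R" | "(u, x2) \<in> ?R"
    | c z where "(c, z) \<in> ?R" "c \<in> {x1, x2}" "z \<in> Y"
    using assms unfolding parcs_eq by blast
  then show False
  proof cases
    case (1 z)
    then show False using dom[of z x1] disj unfolding pverts_eq parcs_del_edge parcs_eq by blast
  next
    case 2
    then show False using dom[of x1 x2] disj unfolding pverts_eq parcs_del_edge parcs_eq by blast
  next
    case 3
    then show False using dom[of x2 x1] disj unfolding pverts_eq parcs_del_edge parcs_eq by blast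
  next
    case (4 c z)
    then show False using dom[of z c] disj unfolding pverts_eq parcs_del_edge parcs_eq by blast
  qed
qed

end

theorem theorem4p3:
  fixes G :: "'a pair_pre_digraph"
  assumes "pair_graph G" and "Digraph_Component.connected (with_proj G)"
  shows "gamma_MB_critical 2 G \<longleftrightarrow>
    (\<exists>n m S B u L x1 x2 Y.
       n \<ge> 1 \<and> m \<ge> 2 \<and>
       complete_bipartite_parts {u} L S \<and> card L = n \<and>
       complete_bipartite_parts {x1, x2} Y B \<and> x1 \<noteq> x2 \<and> card Y = m \<and>
       pverts S \<inter> pverts B = {} \<and>
       G = add_edge u x2 (add_edge u x1 (graph_union S B)))"
proof -
  interpret pair_graph G by fact
  \<comment> \<open>Connectedness, as defined in the library, excludes the empty graph.\<close>
  have ne: "pverts G \<noteq> {}"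
    using assms(2) by (auto simp: connected_def strongly_connected_def)
  note crit = gamma_MB_critical_2_iff[OF pair_finite_verts ne]
  show ?thesis
  proof
    assume "gamma_MB_critical 2 G"
    then obtain d a b where D: "critical_fork G d a b"
      unfolding crit has_dominating_fork_def[of G] critical_fork_def critical_fork_axioms_def
      using assms by blast
    interpret critical_fork G d a b by fact
    \<comment> \<open>The opening move \<open>d\<close> becomes the centre \<open>u\<close>, and its
      partners \<open>a\<close>, \<open>b\<close> become \<open>x1\<close>,
      \<open>x2\<close>.\<close>
    let ?S = "\<lparr> pverts = {d} \<union> L, parcs = {d} \<times> L \<union> L \<times> {d} \<rparr>"
    let ?B = "\<lparr> pverts = {a, b} \<union> Y, parcs = {a, b} \<times> Y \<union> Y \<times> {a, b} \<rparr>"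
    have "complete_bipartite_parts {d} L ?S" "complete_bipartite_parts {a, b} Y ?B"
      using disjoint finite_L finite_Y by (intro complete_bipartite_parts_record; auto)+
    moreover have "pverts ?S \<inter> pverts ?B = {}" using disjoint dist by auto
    moreover have "G = add_edge d b (add_edge d a (graph_union ?S ?B))"
      by (rule pair_pre_digraph.equality)
        (auto simp: add_edge_def graph_union_def pverts_eq parcs_eq)
    moreover have "card L \<ge> 1" using L_nonempty finite_L by (simp add: Suc_le_eq card_gt_0_iff)
    moreover have "a \<noteq> b" using dist by simp
    ultimately show "\<exists>n m S B u L x1 x2 Y.
       n \<ge> 1 \<and> m \<ge> 2 \<and>
       complete_bipartite_parts {u} L S \<and> card L = n \<and>
       complete_bipartite_parts {x1, x2} Y B \<and> x1 \<noteq> x2 \<and> card Y = m \<and>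
       pverts S \<inter> pverts B = {} \<and>
       G = add_edge u x2 (add_edge u x1 (graph_union S B))"
      using card_Y by blast
  next
    assume "\<exists>n m S B u L x1 x2 Y.
       n \<ge> 1 \<and> m \<ge> 2 \<and>
       complete_bipartite_parts {u} L S \<and> card L = n \<and>
       complete_bipartite_parts {x1, x2} Y B \<and> x1 \<noteq> x2 \<and> card Y = m \<and>
       pverts S \<inter> pverts B = {} \<and>
       G = add_edge u x2 (add_edge u x1 (graph_union S B))"
    then obtain S B u L x1 x2 Y where H: "card L \<ge> 1" "card Y \<ge> 2"
      "complete_bipartite_parts {u} L S" "complete_bipartite_parts {x1, x2} Y B" "x1 \<noteq> x2"
      "pverts S \<inter> pverts B = {}" "G = add_edge u x2 (add_edge u x1 (graph_union S B))"
      by blast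
    have "star_joined_K2m G u x1 x2 L Y"
    proof
      show "\<exists>y' \<in> Y. y' \<noteq> y" for y
      proof (rule ccontr)
        assume "\<not> (\<exists>y' \<in> Y. y' \<noteq> y)"
        then have "Y \<subseteq> {y}" by blast
        then have "card Y \<le> card {y}" by (intro card_mono) auto
        with H(2) show False by simp
      qed
      show "L \<noteq> {}" using H(1) by auto
    qed (use H(3-7) in \<open>auto simp: complete_bipartite_parts_def add_edge_def graph_union_def\<close>)
    then interpret star_joined_K2m G u x1 x2 L Y .
    show "gamma_MB_critical 2 G"
      unfolding crit using no_dominating_vertex has_fork no_fork_del_edge by blast
  qed
qed

end
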